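(* Let $\mathcal{F}=(V,\mathcal{A}\cup\mathcal{E})$ be a mixed hypergraph, let $k\in\mathbb{Z}_+$ and let $f,g:V\rightarrow\mathbb{Z}_+$ be functions. There exists a $(k,f,g)$-flexible packing of mixed hyperarborescences in $\mathcal{F}$ if and only if all of the following hold: (1) $f(v)\leq g(v)$ for every $v\in V$; (2) $e_{\mathcal{E}\cup\mathcal{A}}(\mathcal{P})\geq k(|\mathcal{P}|-1)+f(V-\cup\mathcal{P})$ for every subpartition $\mathcal{P}$ of $V$; (3) $e_{\mathcal{E}\cup\mathcal{A}}(\mathcal{P})\geq k|\mathcal{P}|-g(\cup\mathcal{P})$ for every subpartition $\mathcal{P}$ of $V$.
   Context: $\mathbb{Z}_+$ denotes the nonnegative integers. A mixed hypergraph is $\mathcal{F}=(V,\mathcal{A}\cup\mathcal{E})$, where $V$ is a finite nonempty set of vertices, $\mathcal{A}$ is a finite collection of dyperedges and $\mathcal{E}$ is a finite collection of hyperedges (parallel copies are allowed and regarded as distinct elements). A dyperedge is a tuple $a=(tail(a),head(a))$ with $head(a)\in V$ and $tail(a)$ a nonempty subset of $V-\{head(a)\}$; a hyperedge is a subset of $V$ of size at least two. For $X\subseteq V$, $\delta_{\mathcal{E}}(X)$ is the set of $e\in\mathcal{E}$ with $e\cap X\neq\emptyset$ and $e-X\neq\emptyset$, and $\delta^-_{\mathcal{A}}(X)$ is the set of $a\in\mathcal{A}$ with $head(a)\in X$ and $tail(a)-X\neq\emptyset$. A subpartition $\mathcal{P}$ of $V$ is a (possibly empty) collection of pairwise disjoint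 nonempty subsets of $V$; $\cup\mathcal{P}$ is the union of its members; $\mathcal{E}(\mathcal{P})=\bigcup_{X\in\mathcal{P}}\delta_{\mathcal{E}}(X)$, $\mathcal{A}(\mathcal{P})=\bigcup_{X\in\mathcal{P}}\delta^-_{\mathcal{A}}(X)$, and $e_{\mathcal{E}\cup\mathcal{A}}(\mathcal{P})=|\mathcal{E}(\mathcal{P})\cup\mathcal{A}(\mathcal{P})|$. For $h:V\to\mathbb{Z}$ and $X\subseteq V$, $h(X)=\sum_{v\in X}h(v)$, with $h(\emptyset)=0$. An $r$-arborescence is a digraph containing the vertex $r$ whose underlying graph is a tree and in which every vertex except $r$ has exactly one entering arc; it is spanning if its vertex set is $V$. Trimming a dyperedge $a$ means replacing it by an arc $uv$ with $v=head(a)$ and $u\in tail(a)$; trimming a hyperedge $e$ means replacing it by an arc $uv$ with $u\neq v$, $u,v\in e$. A spanning mixed $r$-hyperarborescence of $\mathcal{F}$ is a sub-mixed-hypergraph $(V,\mathcal{A}'\cup\mathcal{E}')$ with $\mathcal{A}'\subseteq\mathcal{A}$, $\mathcal{E}'\subseteq\mathcal{E}$, together with a vertex $r\in V$ (its root), such that its dyperedges and hyperedges can be trimmed (each to one arc) to obtain a spanning $r$-arborescence on $V$. A packing is a collection of such objects that are pairwise disjoint in dyperedges and hyperedges. A packing of $k$ spanning mixed hyperarborescences (each with a specified root) is $(k,f,g)$-flexible if every $v\in V$ is the root of at least $f(v)$ and at most $g(v)$ of them. *)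

theory Defs
  imports Graph_Theory.Graph_Theory "HOL-Library.Disjoint_Sets"
begin

section \<open>Mixed hypergraphs\<close>

text \<open>
  Dyperedges and hyperedges are identifiers with attached incidence functions, so parallel copies
  are distinct elements. The fields \<open>dtail\<close>, \<open>dhead\<close> and \<open>hends\<close> are relevant only on the respective
  sets of identifiers.
\<close>

record ('v, 'd, 'e) mixed_hgraph =
  vertices :: "'v set"
  dyperedges :: "'d set"
  hyperedges :: "'e set"
  dtail :: "'d \<Rightarrow> 'v set"
  dhead :: "'d \<Rightarrow> 'v"
  hends :: "'e \<Rightarrow> 'v set"

locale mixed_hypergraph =
  fixes F :: "('v, 'd, 'e) mixed_hgraph"
  assumes finite_vertices: "finite (vertices F)"
    and vertices_nonempty: "vertices F \<noteq> {}"
    and finite_dyperedges: "finite (dyperedges F)"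
    and finite_hyperedges: "finite (hyperedges F)"
    and dhead_in: "a \<in> dyperedges F \<Longrightarrow> dhead F a \<in> vertices F"
    and dtail_subset: "a \<in> dyperedges F \<Longrightarrow> dtail F a \<subseteq> vertices F - {dhead F a}"
    and dtail_nonempty: "a \<in> dyperedges F \<Longrightarrow> dtail F a \<noteq> {}"
    and hends_subset: "e \<in> hyperedges F \<Longrightarrow> hends F e \<subseteq> vertices F"
    and hends_card: "e \<in> hyperedges F \<Longrightarrow> 2 \<le> card (hends F e)"

definition hyperedge_cut :: "('v, 'd, 'e) mixed_hgraph \<Rightarrow> 'v set \<Rightarrow> 'e set" where
  "hyperedge_cut F X = {e \<in> hyperedges F. hends F e \<inter> X \<noteq> {} \<and> hends F e - X \<noteq> {}}"

definition dyperedge_in_cut :: "('v, 'd, 'e) mixed_hgraph \<Rightarrow> 'v set \<Rightarrow> 'd set" where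
  "dyperedge_in_cut F X = {a \<in> dyperedges F. dhead F a \<in> X \<and> dtail F a - X \<noteq> {}}"

definition subpartition :: "'v set \<Rightarrow> 'v set set \<Rightarrow> bool" where
  "subpartition V P \<longleftrightarrow> \<Union>P \<subseteq> V \<and> disjoint P \<and> {} \<notin> P"

definition entering_number :: "('v, 'd, 'e) mixed_hgraph \<Rightarrow> 'v set set \<Rightarrow> nat" where
  "entering_number F P =
     card ((\<Union>X\<in>P. hyperedge_cut F X) <+> (\<Union>X\<in>P. dyperedge_in_cut F X))"

section \<open>Arborescences\<close>

text \<open>
  The notion \<^const>\<open>tree\<close> of the digraph library only excludes directed cycles, whereas here the
  underlying undirected multigraph has to be a tree. A cycle of that multigraph is a directed cycle
  in the digraph having both orientations of each arc, which uses no arc in both orientations.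
  Thus loops and pairs of parallel or antiparallel arcs count as cycles.
\<close>

definition both_orientations :: "('v, 'a) pre_digraph \<Rightarrow> ('v, 'a \<times> bool) pre_digraph" where
  "both_orientations D =
     \<lparr>verts = verts D,
      arcs = arcs D \<times> UNIV,
      tail = (\<lambda>(a, b). if b then tail D a else head D a),
      head = (\<lambda>(a, b). if b then head D a else tail D a)\<rparr>"

definition underlying_cycle :: "('v, 'a) pre_digraph \<Rightarrow> ('a \<times> bool) list \<Rightarrow> bool" where
  "underlying_cycle D p \<longleftrightarrow>
     pre_digraph.cycle (both_orientations D) p \<and> distinct (map fst p)"

text \<open>The library's \<^const>\<open>Digraph_Component.connected\<close> is weak connectivity.\<close>

definition underlying_tree :: "('v, 'a) pre_digraph \<Rightarrow> bool" where
  "underlying_tree D \<longleftrightarrow> Digraph_Component.connected D \<and> (\<nexists>p. underlying_cycle D p)"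

definition arborescence :: "('v, 'a) pre_digraph \<Rightarrow> 'v \<Rightarrow> bool" where
  "arborescence D r \<longleftrightarrow>
     fin_digraph D \<and> r \<in> verts D \<and> underlying_tree D \<and>
     (\<forall>v \<in> verts D - {r}. in_degree D v = 1)"

section \<open>Packings of mixed hyperarborescences\<close>

definition trimming :: "('v, 'd, 'e) mixed_hgraph \<Rightarrow> ('v, 'd + 'e) pre_digraph \<Rightarrow> bool" where
  "trimming H D \<longleftrightarrow>
     verts D = vertices H \<and>
     arcs D = dyperedges H <+> hyperedges H \<and>
     (\<forall>a \<in> dyperedges H. head D (Inl a) = dhead H a \<and> tail D (Inl a) \<in> dtail H a) \<and>
     (\<forall>e \<in> hyperedges H. tail D (Inr e) \<in> hends H e \<and> head D (Inr e) \<in> hends H e \<and>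
        tail D (Inr e) \<noteq> head D (Inr e))"

definition spanning_hyperarborescence ::
  "('v, 'd, 'e) mixed_hgraph \<Rightarrow> 'v \<Rightarrow> 'd set \<Rightarrow> 'e set \<Rightarrow> bool" where
  "spanning_hyperarborescence F r A E \<longleftrightarrow>
     r \<in> vertices F \<and> A \<subseteq> dyperedges F \<and> E \<subseteq> hyperedges F \<and>
     (\<exists>D. trimming (F\<lparr>dyperedges := A, hyperedges := E\<rparr>) D \<and> arborescence D r)"

text \<open>
  A packing is an indexed family: if there is only one vertex, its members may coincide, with no
  dyperedges and no hyperedges, and have to be counted with multiplicity.
\<close>

definition hyperarborescence_packing ::
  "('v, 'd, 'e) mixed_hgraph \<Rightarrow> nat \<Rightarrow> (nat \<Rightarrow> 'v) \<Rightarrow> (nat \<Rightarrow> 'd set) \<Rightarrow> (nat \<Rightarrow> 'e set) \<Rightarrow> bool" where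
  "hyperarborescence_packing F k r A E \<longleftrightarrow>
     (\<forall>i<k. spanning_hyperarborescence F (r i) (A i) (E i)) \<and>
     disjoint_family_on A {..<k} \<and> disjoint_family_on E {..<k}"

definition flexible_packing ::
  "('v, 'd, 'e) mixed_hgraph \<Rightarrow> nat \<Rightarrow> ('v \<Rightarrow> nat) \<Rightarrow> ('v \<Rightarrow> nat) \<Rightarrow>
   (nat \<Rightarrow> 'v) \<Rightarrow> (nat \<Rightarrow> 'd set) \<Rightarrow> (nat \<Rightarrow> 'e set) \<Rightarrow> bool" where
  "flexible_packing F k f g r A E \<longleftrightarrow>
     hyperarborescence_packing F k r A E \<and>
     (\<forall>v \<in> vertices F. f v \<le> card {i. i < k \<and> r i = v} \<and> card {i. i < k \<and> r i = v} \<le> g v)"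

end

theory Submission
  imports Defs
begin

text \<open>
  Uncrossing two subpartitions into a common refinement of their intersection and a join shows
  that, for root multiplicities \<open>m\<close>, the subpartitions \<open>P\<close> attaining equality in
  \<open>e(P) \<ge> k |P| - m(\<Union>P)\<close> have their unions closed under union and intersection. Closure under
  union makes a minimal \<open>m\<close> between \<open>f\<close> and \<open>g\<close> satisfying all these inequalities have total \<open>k\<close>.
  Closure under intersection lets every hyperedge be given a head without violating any of them.
  The inequalities for one-element subpartitions are then the in-degree condition of Edmonds'
  branching theorem, and Lovasz's proof of it works for dyperedges without trimming them first.
  Conversely, every arborescence enters each set that avoids its root.
\<close>

section \<open>Uncrossing subpartitions\<close>

text \<open>
  An edge is described by the set \<open>H\<close> of its possible heads and the set \<open>W\<close> of all its vertices:
  \<open>H\<close> is a singleton for a dyperedge, and \<open>H = W\<close> for a hyperedge.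
\<close>

definition crosses :: "'v set \<Rightarrow> 'v set \<Rightarrow> 'v set set \<Rightarrow> bool" where
  "crosses H W P \<longleftrightarrow> H \<inter> \<Union>P \<noteq> {} \<and> \<not> (\<exists>X\<in>P. W \<subseteq> X)"

definition cross_num :: "'a set \<Rightarrow> ('a \<Rightarrow> 'v set) \<Rightarrow> ('a \<Rightarrow> 'v set) \<Rightarrow> 'v set set \<Rightarrow> nat" where
  "cross_num S H W P = card {a \<in> S. crosses (H a) (W a) P}"

lemma cross_num_sum:
  "finite S \<Longrightarrow> cross_num S H W P = (\<Sum>a\<in>S. of_bool (crosses (H a) (W a) P))"
  by (simp add: cross_num_def Int_def)

lemma crosses_singleton: "crosses {v} W {X} \<longleftrightarrow> v \<in> X \<and> \<not> W \<subseteq> X"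
  by (auto simp: crosses_def)

lemma finite_subpartition: "finite V \<Longrightarrow> subpartition V P \<Longrightarrow> finite P"
  unfolding subpartition_def by (meson Sup_le_iff finite_UnionD finite_subset)

section \<open>Intersection and join of two subpartitions\<close>

definition meets :: "'v set set \<Rightarrow> 'v set set \<Rightarrow> 'v set set" where
  "meets P Q = {A \<inter> B |A B. A \<in> P \<and> B \<in> Q} - {{}}"

lemma subpartition_meets:
  assumes "subpartition V P" "subpartition V Q"
  shows "subpartition V (meets P Q)"
  using assms unfolding subpartition_def meets_def disjoint_def by blast

lemma Union_meets: "\<Union>(meets P Q) = \<Union>P \<inter> \<Union>Q"
  unfolding meets_def by blast

text \<open>
  Members of \<open>P\<close> and \<open>Q\<close> are the two sides of a bipartite graph whose edges are the nonempty
  intersections; the members of the join are its components, so the cardinality bound says that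
  vertices minus components is at most the number of edges.
\<close>
lemma join_exists:
  assumes "finite P" "finite Q" "disjoint P" "disjoint Q" "{} \<notin> P" "{} \<notin> Q"
  shows "\<exists>J. finite J \<and> disjoint J \<and> {} \<notin> J \<and> \<Union>J = \<Union>P \<union> \<Union>Q \<and>
    (\<forall>A\<in>P \<union> Q. \<exists>C\<in>J. A \<subseteq> C) \<and> card P + card Q \<le> card (meets P Q) + card J"
  using assms(2,4,6)
proof (induction Q rule: finite_induct)
  case empty
  then show ?case using assms by (intro exI[of _ P]) auto
next
  case (insert B Q)
  have dQ: "disjoint Q" "{} \<notin> Q" and B: "B \<noteq> {}" and dB: "\<And>A. A \<in> Q \<Longrightarrow> A \<inter> B = {}"
    using insert by (auto simp: disjoint_def)
  obtain J where J: "finite J" "disjoint J" "{} \<notin> J" "\<Union>J = \<Union>P \<union> \<Union>Q"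
    "\<forall>A\<in>P \<union> Q. \<exists>C\<in>J. A \<subseteq> C" "card P + card Q \<le> card (meets P Q) + card J"
    using insert.IH dQ by blast
  \<comment> \<open>The new vertex \<open>B\<close> of the bipartite graph merges the components in
    \<open>N\<close> into the single component \<open>C0\<close>; if \<open>N\<close> is empty,
    \<open>B\<close> becomes a component by itself.\<close>
  define N where "N = {C\<in>J. C \<inter> B \<noteq> {}}"
  define C0 where "C0 = B \<union> \<Union>N"
  define J' where "J' = insert C0 (J - N)"
  have finN: "finite N" and NJ: "N \<subseteq> J" using J by (auto simp: N_def)
  have sep: "A \<inter> C0 = {}" if "A \<in> J - N" for A
  proof -
    have "A \<inter> B = {}" using that by (auto simp: N_def)
    moreover have "A \<inter> C = {}" if "C \<in> N" for C
    proof -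
      have "C \<in> J" "A \<in> J" "A \<noteq> C" using \<open>A \<in> J - N\<close> that NJ by auto
      then show ?thesis using J(2) unfolding disjoint_def by blast
    qed
    ultimately show ?thesis by (auto simp: C0_def)
  qed
  have C0_new: "C0 \<notin> J - N" using sep B by (auto simp: C0_def)
  have card_J': "card J' + card N = card J + 1"
    using C0_new J(1) NJ finN card_mono[OF J(1) NJ]
    by (simp add: J'_def card_Diff_subset)
  \<comment> \<open>Each merged component yields its own new edge at \<open>B\<close>: a common
    point of \<open>C\<close> and \<open>B\<close> lies outside \<open>\<Union>Q\<close>, hence in a
    member of \<open>P\<close>, which \<open>C\<close> then contains. So at least
    \<open>card N\<close> new edges pay for the one new vertex and the \<open>card N - 1\<close>
    lost components.\<close>
  have "\<exists>A\<in>P. A \<inter> B \<noteq> {} \<and> A \<subseteq> C" if "C \<in> N" for C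
  proof -
    obtain x where x: "x \<in> C" "x \<in> B" "C \<in> J" using \<open>C \<in> N\<close> by (auto simp: N_def)
    have "x \<notin> \<Union>Q" using dB x by auto
    then obtain A where A: "A \<in> P" "x \<in> A" using x J(4) by blast
    then obtain C' where C': "C' \<in> J" "A \<subseteq> C'" using J(5) by blast
    then have "C' = C" using x A J(2) by (auto simp: disjoint_def)
    then show ?thesis using A C' x by auto
  qed
  then obtain w where w: "\<And>C. C \<in> N \<Longrightarrow> w C \<in> P \<and> w C \<inter> B \<noteq> {} \<and> w C \<subseteq> C" by metis
  have inj: "inj_on (\<lambda>C. w C \<inter> B) N"
  proof (rule inj_onI)
    fix C D assume "C \<in> N" "D \<in> N" "w C \<inter> B = w D \<inter> B"
    then have "C \<inter> D \<noteq> {}" using w[of C] w[of D] by auto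
    then show "C = D" using J(2) \<open>C \<in> N\<close> \<open>D \<in> N\<close> NJ by (auto simp: disjoint_def)
  qed
  have sub: "meets P Q \<union> (\<lambda>C. w C \<inter> B) ` N \<subseteq> meets P (insert B Q)"
    using w by (auto simp: meets_def)
  have "meets P Q \<inter> (\<lambda>C. w C \<inter> B) ` N = {}"
    using dB w by (fastforce simp: meets_def)
  moreover have fin: "finite (meets P X)" if "finite X" for X :: "'a set set"
  proof -
    have "meets P X \<subseteq> (\<lambda>(A, B). A \<inter> B) ` (P \<times> X)" by (auto simp: meets_def)
    then show ?thesis using that assms(1) by (meson finite_SigmaI finite_imageI finite_subset)
  qed
  ultimately have "card (meets P Q) + card N = card (meets P Q \<union> (\<lambda>C. w C \<inter> B) ` N)"
    using finN insert.hyps by (subst card_Un_disjoint) (auto simp: card_image inj)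
  also have "\<dots> \<le> card (meets P (insert B Q))"
    using sub fin insert.hyps by (intro card_mono) auto
  finally have "card P + card (insert B Q) \<le> card (meets P (insert B Q)) + card J'"
    using J(6) card_J' insert.hyps by simp
  moreover have "disjoint J'" using sep J(2) by (auto simp: J'_def disjoint_def)
  moreover have "\<Union>J' = \<Union>P \<union> \<Union>(insert B Q)" 
  proof -
    have "\<Union>J' = B \<union> \<Union>J" using NJ unfolding J'_def C0_def by blast
    then show ?thesis using J(4) by auto
  qed
  moreover have "\<exists>C\<in>J'. A \<subseteq> C" if A: "A \<in> P \<union> insert B Q" for A
  proof (cases "A = B")
    case False
    then obtain C where "C \<in> J" "A \<subseteq> C" using A J(5) by blast
    then show ?thesis by (cases "C \<in> N") (auto simp: J'_def C0_def)
  qed (auto simp: J'_def C0_def)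
  ultimately show ?case using J B
    by (intro exI[of _ J']) (auto simp: J'_def C0_def)
qed

text \<open>If a member of \<open>P\<close> contains \<open>W\<close>, so does a member of
  \<open>J\<close>, and \<open>J\<close> is not crossed. Crossing the meet then forces crossing
  \<open>Q\<close>: members of \<open>P\<close> and \<open>Q\<close> containing \<open>W\<close>
  would have an intersection containing \<open>W\<close>, nonempty because \<open>H\<close> is. The
  roles of \<open>P\<close> and \<open>Q\<close> are symmetric. If no member of either contains
  \<open>W\<close>, crossing \<open>P\<close> or \<open>Q\<close> only means that \<open>H\<close>
  meets its union.\<close>

lemma crosses_submodular:
  assumes "H \<noteq> {}" "H \<subseteq> W" "\<Union>J = \<Union>P \<union> \<Union>Q" "\<forall>A\<in>P \<union> Q. \<exists>C\<in>J. A \<subseteq> C"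
  shows "of_bool (crosses H W (meets P Q)) + of_bool (crosses H W J)
    \<le> of_bool (crosses H W P) + (of_bool (crosses H W Q) :: nat)"
proof -
  have P: "\<not> crosses H W J \<and> (crosses H W (meets P Q) \<longrightarrow> crosses H W Q)" if "A \<in> P" "W \<subseteq> A" for A
  proof -
    have "\<exists>C\<in>J. W \<subseteq> C" using that assms(4) by (meson UnI1 UnI2 order_trans)
    moreover have "\<exists>C\<in>meets P Q. W \<subseteq> C" if "B \<in> Q" "W \<subseteq> B" for B
    proof (rule bexI)
      show "W \<subseteq> A \<inter> B" using that \<open>W \<subseteq> A\<close> by simp
      then have "A \<inter> B \<noteq> {}" using assms(1,2) by auto
      then show "A \<inter> B \<in> meets P Q" using that \<open>A \<in> P\<close> by (auto simp: meets_def)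
    qed
    ultimately show ?thesis unfolding crosses_def Union_meets by auto
  qed
  have Q: "\<not> crosses H W J \<and> (crosses H W (meets P Q) \<longrightarrow> crosses H W P)" if "B \<in> Q" "W \<subseteq> B" for B
  proof -
    have "\<exists>C\<in>J. W \<subseteq> C" using that assms(4) by (meson UnI1 UnI2 order_trans)
    moreover have "\<exists>C\<in>meets P Q. W \<subseteq> C" if "A \<in> P" "W \<subseteq> A" for A
    proof (rule bexI)
      show "W \<subseteq> A \<inter> B" using that \<open>W \<subseteq> B\<close> by simp
      then have "A \<inter> B \<noteq> {}" using assms(1,2) by auto
      then show "A \<inter> B \<in> meets P Q" using that \<open>B \<in> Q\<close> by (auto simp: meets_def)
    qed
    ultimately show ?thesis unfolding crosses_def Union_meets by auto
  qed
  show ?thesis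
  proof (cases "(\<exists>A\<in>P. W \<subseteq> A) \<or> (\<exists>A\<in>Q. W \<subseteq> A)")
    case True
    then show ?thesis using P Q by (auto simp: of_bool_def)
  next
    case False
    then have "crosses H W P \<longleftrightarrow> H \<inter> \<Union>P \<noteq> {}" "crosses H W Q \<longleftrightarrow> H \<inter> \<Union>Q \<noteq> {}"
      by (auto simp: crosses_def)
    moreover have "crosses H W (meets P Q) \<Longrightarrow> H \<inter> \<Union>P \<noteq> {} \<and> H \<inter> \<Union>Q \<noteq> {}"
      unfolding crosses_def Union_meets by blast
    moreover have "crosses H W J \<Longrightarrow> H \<inter> \<Union>P \<noteq> {} \<or> H \<inter> \<Union>Q \<noteq> {}"
      unfolding crosses_def assms(3) by blast
    ultimately show ?thesis by (auto simp: of_bool_def)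
  qed
qed

lemma uncross:
  assumes "finite V" "subpartition V P" "subpartition V Q"
  obtains M J where "subpartition V M" "subpartition V J"
    "\<Union>M = \<Union>P \<inter> \<Union>Q" "\<Union>J = \<Union>P \<union> \<Union>Q" "card P + card Q \<le> card M + card J"
    "\<And>H W. H \<noteq> {} \<Longrightarrow> H \<subseteq> W \<Longrightarrow> of_bool (crosses H W M) + of_bool (crosses H W J)
      \<le> of_bool (crosses H W P) + (of_bool (crosses H W Q) :: nat)"
proof -
  have "finite P" "finite Q" using assms finite_subpartition by auto
  then obtain J where J: "finite J" "disjoint J" "{} \<notin> J" "\<Union>J = \<Union>P \<union> \<Union>Q"
    "\<forall>A\<in>P \<union> Q. \<exists>C\<in>J. A \<subseteq> C" "card P + card Q \<le> card (meets P Q) + card J"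
    using join_exists[of P Q] assms(2,3) unfolding subpartition_def by blast
  have "subpartition V J" using J assms(2,3) unfolding subpartition_def by simp
  then show ?thesis
    using that[OF subpartition_meets[OF assms(2,3)] _ Union_meets J(4,6)]
      crosses_submodular[OF _ _ J(4,5)] by blast
qed

section \<open>Root multiplicities and heads of hyperedges\<close>

text \<open>The inequality for \<open>g\<close> in the theorem, with \<open>m\<close> in place of
  \<open>g\<close> and rearranged to avoid subtraction. For \<open>m\<close> of total
  \<open>k\<close> lying above \<open>f\<close> it also yields the inequality for
  \<open>f\<close>.\<close>

definition demand_met ::
  "'v set \<Rightarrow> 'a set \<Rightarrow> ('a \<Rightarrow> 'v set) \<Rightarrow> ('a \<Rightarrow> 'v set) \<Rightarrow> nat \<Rightarrow> ('v \<Rightarrow> nat) \<Rightarrow> bool" where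
  "demand_met V S H W k m \<longleftrightarrow>
     (\<forall>P. subpartition V P \<longrightarrow> k * card P \<le> cross_num S H W P + sum m (\<Union>P))"

definition tight ::
  "'v set \<Rightarrow> 'a set \<Rightarrow> ('a \<Rightarrow> 'v set) \<Rightarrow> ('a \<Rightarrow> 'v set) \<Rightarrow> nat \<Rightarrow> ('v \<Rightarrow> nat) \<Rightarrow> 'v set set \<Rightarrow> bool" where
  "tight V S H W k m P \<longleftrightarrow>
     subpartition V P \<and> k * card P = cross_num S H W P + sum m (\<Union>P)"

text \<open>Adding the equalities for \<open>P\<close> and \<open>Q\<close> and comparing with the
  demands of \<open>M\<close> and \<open>J\<close> squeezes every inequality from uncrossing into an
  equality.\<close>

lemma tight_uncross:
  assumes fin: "finite V" "finite S" and dem: "demand_met V S H W k m"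
    and H: "\<And>a. a \<in> S \<Longrightarrow> H a \<noteq> {} \<and> H a \<subseteq> W a"
    and P: "tight V S H W k m P" and Q: "tight V S H W k m Q"
  obtains M J where "tight V S H W k m M" "tight V S H W k m J"
    "\<Union>M = \<Union>P \<inter> \<Union>Q" "\<Union>J = \<Union>P \<union> \<Union>Q"
    "\<And>a. a \<in> S \<Longrightarrow> crosses (H a) (W a) P \<Longrightarrow> crosses (H a) (W a) Q \<Longrightarrow> crosses (H a) (W a) M"
proof -
  have sP: "subpartition V P" and sQ: "subpartition V Q" using P Q by (auto simp: tight_def)
  obtain M J where MJ: "subpartition V M" "subpartition V J"
    "\<Union>M = \<Union>P \<inter> \<Union>Q" "\<Union>J = \<Union>P \<union> \<Union>Q" "card P + card Q \<le> card M + card J"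
    "\<And>H W. H \<noteq> {} \<Longrightarrow> H \<subseteq> W \<Longrightarrow> of_bool (crosses H W M) + of_bool (crosses H W J)
      \<le> of_bool (crosses H W P) + (of_bool (crosses H W Q) :: nat)"
    using uncross[OF fin(1) sP sQ] by blast
  let ?c = "\<lambda>P a. of_bool (crosses (H a) (W a) P) :: nat"
  have le: "?c M a + ?c J a \<le> ?c P a + ?c Q a" if "a \<in> S" for a
    using MJ(6)[of "H a" "W a"] H[OF that] by simp
  have cs: "(\<Sum>a\<in>S. ?c X a + ?c Y a) = cross_num S H W X + cross_num S H W Y" for X Y
    using fin by (simp add: cross_num_sum sum.distrib)
  have "finite (\<Union>P)" "finite (\<Union>Q)"
    using sP sQ fin by (auto simp: subpartition_def intro: finite_subset)
  then have msum: "sum m (\<Union>J) + sum m (\<Union>M) = sum m (\<Union>P) + sum m (\<Union>Q)"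
    unfolding MJ(3,4) by (rule sum.union_inter)
  have mono: "cross_num S H W M + cross_num S H W J \<le> cross_num S H W P + cross_num S H W Q"
    unfolding cs[symmetric] by (intro sum_mono le)
  have dM: "k * card M \<le> cross_num S H W M + sum m (\<Union>M)"
    and dJ: "k * card J \<le> cross_num S H W J + sum m (\<Union>J)"
    using dem MJ(1,2) by (auto simp: demand_met_def)
  have card: "k * card P + k * card Q \<le> k * card M + k * card J"
    using MJ(5) by (metis distrib_left mult_le_mono2)
  have eqs: "k * card P = cross_num S H W P + sum m (\<Union>P)"
    "k * card Q = cross_num S H W Q + sum m (\<Union>Q)" using P Q by (auto simp: tight_def)
  have tM: "tight V S H W k m M" and tJ: "tight V S H W k m J"
    using dM dJ card eqs mono msum MJ(1,2) unfolding tight_def by linarith+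
  have "cross_num S H W M + cross_num S H W J = cross_num S H W P + cross_num S H W Q"
    using dM dJ card eqs mono msum by linarith
  then have "(\<Sum>a\<in>S. ?c M a + ?c J a) = (\<Sum>a\<in>S. ?c P a + ?c Q a)"
    unfolding cs .
  \<comment> \<open>Termwise inequalities with equal sums are termwise equalities, so an edge
    crossing both \<open>P\<close> and \<open>Q\<close> crosses both \<open>M\<close> and
    \<open>J\<close>.\<close>
  then have eq: "?c M a + ?c J a = ?c P a + ?c Q a" if "a \<in> S" for a
    using sum_mono_inv[of "\<lambda>a. ?c M a + ?c J a" S "\<lambda>a. ?c P a + ?c Q a", OF _ le that fin(2)]
    by blast
  have "crosses (H a) (W a) M"
    if "a \<in> S" "crosses (H a) (W a) P" "crosses (H a) (W a) Q" for a
    using eq[OF that(1)] that(2,3) by (auto simp: of_bool_def split: if_splits)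
  then show ?thesis using that tM tJ MJ(3,4) by blast
qed

text \<open>
  A head \<open>v\<close> is refused only by a tight subpartition crossed by \<open>a\<close> whose union misses \<open>v\<close>. If all
  heads were refused, a crossed tight subpartition with smallest union could be intersected further.
\<close>
lemma single_head_step:
  assumes fin: "finite V" "finite S" and dem: "demand_met V S H W k m"
    and H: "\<And>a. a \<in> S \<Longrightarrow> H a \<noteq> {} \<and> H a \<subseteq> W a" and a: "a \<in> S"
  shows "\<exists>v\<in>H a. demand_met V S (H(a := {v})) W k m"
proof (rule ccontr)
  assume neg: "\<not> ?thesis"
  let ?bad = "\<lambda>P. tight V S H W k m P \<and> crosses (H a) (W a) P"
  have "\<exists>P. ?bad P \<and> v \<notin> \<Union>P" if v: "v \<in> H a" for v
  proof -
    let ?H = "H(a := {v})"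
    have "\<not> demand_met V S ?H W k m" using neg v by blast
    then obtain P where P: "subpartition V P"
      "cross_num S ?H W P + sum m (\<Union>P) < k * card P"
      by (auto simp: demand_met_def not_le)
    have le: "k * card P \<le> cross_num S H W P + sum m (\<Union>P)"
      using dem P by (auto simp: demand_met_def)
    have rest: "cross_num S G W P = of_bool (crosses (G a) (W a) P) + cross_num (S - {a}) G W P" for G
      using a fin(2) by (simp add: cross_num_sum sum.remove del: sum_of_bool_eq)
    \<comment> \<open>Only the contribution of \<open>a\<close> changes, and by at most one. So a
      demand that fails for the new head was tight before, and \<open>a\<close> crossed
      \<open>P\<close> before but no longer does.\<close>
    have "cross_num (S - {a}) ?H W P = cross_num (S - {a}) H W P"
      unfolding cross_num_def by (rule arg_cong[where f = card]) auto
    then have "crosses (H a) (W a) P" "\<not> crosses {v} (W a) P"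
        "k * card P = cross_num S H W P + sum m (\<Union>P)"
      using rest[of H] rest[of ?H] le P(2) by (auto simp: of_bool_def split: if_splits)
    then show ?thesis using P(1) by (intro exI[of _ P]) (auto simp: tight_def crosses_def)
  qed
  then obtain T where T: "\<And>v. v \<in> H a \<Longrightarrow> ?bad (T v) \<and> v \<notin> \<Union>(T v)" by metis
  obtain v0 where "v0 \<in> H a" using H a by blast
  then have "?bad (T v0)" using T by blast
  then obtain P where P: "?bad P" and min: "\<And>Q. ?bad Q \<Longrightarrow> card (\<Union>P) \<le> card (\<Union>Q)"
    using ex_has_least_nat[of ?bad "T v0" "\<lambda>P. card (\<Union>P)"] by blast
  obtain v where v: "v \<in> H a" "v \<in> \<Union>P" using P by (auto simp: crosses_def)
  have tP: "tight V S H W k m P" and tT: "tight V S H W k m (T v)" using P T v by auto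
  obtain M where M: "tight V S H W k m M" "\<Union>M = \<Union>P \<inter> \<Union>(T v)"
    "crosses (H a) (W a) P \<Longrightarrow> crosses (H a) (W a) (T v) \<Longrightarrow> crosses (H a) (W a) M"
    using tight_uncross[OF fin dem H tP tT] a by metis
  then have "?bad M" using P T v by blast
  moreover have "card (\<Union>M) < card (\<Union>P)"
  proof (rule psubset_card_mono)
    show "finite (\<Union>P)" using tP fin by (auto simp: tight_def subpartition_def intro: finite_subset)
    show "\<Union>M \<subset> \<Union>P" using M(2) v T by blast
  qed
  ultimately show False using min by fastforce
qed

text \<open>Edges receive their heads one at a time; the sets of possible heads stay nonempty and
  inside \<open>W\<close>, as the next step requires.\<close>

lemma single_heads:
  assumes fin: "finite V" "finite S" and dem: "demand_met V S H W k m"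
    and H: "\<And>a. a \<in> S \<Longrightarrow> H a \<noteq> {} \<and> H a \<subseteq> W a"
  shows "\<exists>h. (\<forall>a\<in>S. h a \<in> H a) \<and> demand_met V S (\<lambda>a. {h a}) W k m"
proof -
  have "\<exists>h. (\<forall>a\<in>T. h a \<in> H a) \<and> demand_met V S (\<lambda>a. if a \<in> T then {h a} else H a) W k m"
    if "finite T" "T \<subseteq> S" for T
    using that
  proof (induction T rule: finite_induct)
    case (insert a T)
    then obtain h where h: "\<forall>a\<in>T. h a \<in> H a"
      "demand_met V S (\<lambda>a. if a \<in> T then {h a} else H a) W k m" (is "demand_met V S ?H W k m") by auto
    have "?H b \<noteq> {} \<and> ?H b \<subseteq> W b" if "b \<in> S" for b using h(1) H[OF that] by auto
    then obtain v where v: "v \<in> ?H a" "demand_met V S (?H(a := {v})) W k m"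
      using single_head_step[OF fin h(2), of a] insert.prems by blast
    have "?H(a := {v}) = (\<lambda>b. if b \<in> insert a T then {(h(a := v)) b} else H b)"
      by (auto simp: fun_eq_iff insert.hyps)
    then show ?case using h(1) v insert.hyps by (intro exI[of _ "h(a := v)"]) auto
  qed (use dem in auto)
  from this[of S] obtain h where h: "\<forall>a\<in>S. h a \<in> H a"
    "demand_met V S (\<lambda>a. if a \<in> S then {h a} else H a) W k m" using fin by auto
  have "cross_num S (\<lambda>a. if a \<in> S then {h a} else H a) W P = cross_num S (\<lambda>a. {h a}) W P" for P
    unfolding cross_num_def by (rule arg_cong[where f = card]) auto
  then show ?thesis using h unfolding demand_met_def by auto
qed

text \<open>Among feasible vectors, \<open>g\<close> being one, take \<open>m\<close> of least
  total. Each \<open>v\<close> with \<open>f v < m v\<close> lies in the union of a tight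
  subpartition, and a tight \<open>P\<close> with largest union covers all such \<open>v\<close>.
  Outside \<open>\<Union>P\<close>, \<open>m\<close> equals \<open>f\<close>, so tightness of
  \<open>P\<close> and the bound for \<open>f\<close> give total at most \<open>k\<close>. The
  subpartition \<open>{V}\<close>, crossed by no edge, gives at least \<open>k\<close>.\<close>

lemma root_vector:
  assumes fin: "finite V" "finite S" and H: "\<And>a. a \<in> S \<Longrightarrow> H a \<noteq> {} \<and> H a \<subseteq> W a"
    and fg: "\<And>v. v \<in> V \<Longrightarrow> f v \<le> g v" and dem: "demand_met V S H W k g"
    and f: "\<And>P. subpartition V P \<Longrightarrow> k * card P + sum f (V - \<Union>P) \<le> cross_num S H W P + k"
    and V: "V \<noteq> {}" and W: "\<And>a. a \<in> S \<Longrightarrow> W a \<subseteq> V"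
  shows "\<exists>m. (\<forall>v\<in>V. f v \<le> m v \<and> m v \<le> g v) \<and> sum m V = k \<and> demand_met V S H W k m"
proof -
  let ?ok = "\<lambda>m. (\<forall>v\<in>V. f v \<le> m v \<and> m v \<le> g v) \<and> demand_met V S H W k m"
  have "?ok g" using fg dem by auto
  then obtain m where m: "?ok m" and min: "\<And>m'. ?ok m' \<Longrightarrow> sum m V \<le> sum m' V"
    using ex_has_least_nat[of ?ok g "\<lambda>m. sum m V"] by blast
  have dm: "demand_met V S H W k m" using m by blast
  \<comment> \<open>The empty subpartition guarantees that a tight one with largest union
    exists.\<close>
  have emp: "tight V S H W k m {}" 
    by (auto simp: tight_def subpartition_def cross_num_def crosses_def)
  have tv: "\<exists>P. tight V S H W k m P \<and> v \<in> \<Union>P" if v: "v \<in> V" "f v < m v" for v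
  proof -
    \<comment> \<open>Lowering \<open>m v\<close> by one respects the bounds, so by minimality of
      \<open>m\<close> it breaks some demand; that demand was tight, and its union contains
      \<open>v\<close>.\<close>
    let ?m = "m(v := m v - 1)"
    have split: "sum m X = (if v \<in> X then 1 else 0) + sum ?m X" if "X \<subseteq> V" for X
    proof -
      have "finite X" using that fin finite_subset by blast
      then show ?thesis using v by (auto simp: sum.remove[of X v] intro!: sum.cong)
    qed
    have "\<not> ?ok ?m" using min[of ?m] split[of V] v by fastforce
    moreover have "\<forall>u\<in>V. f u \<le> ?m u \<and> ?m u \<le> g u" 
    proof
      fix u assume "u \<in> V" then have "f u \<le> m u \<and> m u \<le> g u" using m by blast
      then show "f u \<le> ?m u \<and> ?m u \<le> g u" using v by auto
    qed
    ultimately obtain P where P: "subpartition V P"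
      "cross_num S H W P + sum ?m (\<Union>P) < k * card P"
      by (auto simp: demand_met_def not_le)
    moreover have "k * card P \<le> cross_num S H W P + sum m (\<Union>P)"
      using dm P(1) by (auto simp: demand_met_def)
    ultimately show ?thesis using split[of "\<Union>P"]
      by (intro exI[of _ P]) (auto simp: tight_def subpartition_def split: if_splits)
  qed
  obtain P where P: "tight V S H W k m P"
    and max: "\<And>Q. tight V S H W k m Q \<Longrightarrow> card (\<Union>Q) \<le> card (\<Union>P)"
  proof -
    have "\<forall>Q. tight V S H W k m Q \<longrightarrow> card (\<Union>Q) < Suc (card V)"
      using fin by (auto simp: tight_def subpartition_def less_Suc_eq_le intro!: card_mono)
    from Lattices_Big.ex_has_greatest_nat[of "tight V S H W k m", OF emp this]
    show ?thesis using that by metis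
  qed
  have sP: "subpartition V P" and eqP: "k * card P = cross_num S H W P + sum m (\<Union>P)"
    using P by (auto simp: tight_def)
  have "f v = m v" if v: "v \<in> V - \<Union>P" for v
  proof (rule ccontr)
    assume "f v \<noteq> m v"
    moreover have "f v \<le> m v" using m v by blast
    ultimately have "f v < m v" by simp
    then obtain Q where Q: "tight V S H W k m Q" "v \<in> \<Union>Q" using tv[of v] v by auto
    obtain J where J: "tight V S H W k m J" "\<Union>J = \<Union>P \<union> \<Union>Q"
      using tight_uncross[OF fin dm H P Q(1)] by metis
    have "card (\<Union>P) < card (\<Union>J)"
    proof (rule psubset_card_mono)
      show "finite (\<Union>J)" using J fin by (auto simp: tight_def subpartition_def intro: finite_subset)
      show "\<Union>P \<subset> \<Union>J" using J(2) v Q by blast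
    qed
    then show False using max[OF J(1)] by simp
  qed
  then have "sum f (V - \<Union>P) = sum m (V - \<Union>P)" by simp
  moreover have "sum m V = sum m (V - \<Union>P) + sum m (\<Union>P)"
    using sP fin by (intro sum.subset_diff) (auto simp: subpartition_def)
  ultimately have le: "sum m V \<le> k" using f[OF sP] eqP by linarith
  have "{a \<in> S. crosses (H a) (W a) {V}} = {}" using W by (auto simp: crosses_def)
  then have "cross_num S H W {V} = 0" unfolding cross_num_def by (metis card.empty)
  moreover have "subpartition V {V}" using V by (auto simp: subpartition_def)
  ultimately have "k \<le> sum m V" using dm unfolding demand_met_def by force
  then show ?thesis using m le by (intro exI[of _ m]) auto
qed

section \<open>Disjoint branchings\<close>

text \<open>A branching with root set \<open>R\<close>, described by an order in which it can be
  grown: each edge has a new head and meets the set reached so far. Tails are left unchosen, so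
  dyperedges need no trimming yet. The first edge grown is outermost, which fits an induction on
  enlarging \<open>R\<close>.\<close>

inductive spans :: "'v set \<Rightarrow> ('a \<Rightarrow> 'v) \<Rightarrow> ('a \<Rightarrow> 'v set) \<Rightarrow> 'v set \<Rightarrow> 'a set \<Rightarrow> bool"
  for V h W where
  full: "spans V h W V {}"
| step: "spans V h W (insert (h a) R) B \<Longrightarrow> W a \<inter> R \<noteq> {} \<Longrightarrow> h a \<in> V - R \<Longrightarrow> a \<notin> B \<Longrightarrow>
    spans V h W R (insert a B)"

lemma spans_rank:
  assumes "spans V h W R B"
  shows "\<exists>t \<rho>. inj_on h B \<and> h ` B = V - R \<and> R \<subseteq> V \<and>
    (\<forall>a\<in>B. t a \<in> W a \<and> t a \<in> V \<and> \<rho> (t a) < (\<rho> (h a) :: nat))"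
  using assms
proof induction
  case (step a R B)
  obtain t \<rho> where IH: "inj_on h B" "h ` B = V - insert (h a) R" "insert (h a) R \<subseteq> V"
    "\<And>b. b \<in> B \<Longrightarrow> t b \<in> W b \<and> t b \<in> V \<and> \<rho> (t b) < (\<rho> (h b) :: nat)"
    using step.IH by meson
  obtain u where u: "u \<in> W a" "u \<in> R" using step by blast
  \<comment> \<open>The rank records the stage at which a vertex is reached: old ranks move up by
    one to leave rank 0 for \<open>R\<close>, where the tail of \<open>a\<close> is chosen.\<close>
  let ?t = "t(a := u)" and ?\<rho> = "\<lambda>x. if x \<in> R then 0 else Suc (\<rho> x)"
  have "h b \<notin> R" if "b \<in> B" for b using IH(2) that by blast
  moreover have "h a \<notin> h ` B" using IH(2) by blast
  moreover have "h ` insert a B = V - R" using IH(2) step by blast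
  ultimately have "inj_on h (insert a B) \<and> h ` insert a B = V - R \<and> R \<subseteq> V \<and>
    (\<forall>b\<in>insert a B. ?t b \<in> W b \<and> ?t b \<in> V \<and> ?\<rho> (?t b) < ?\<rho> (h b))"
    using IH u step by auto
  then show ?case by (intro exI)
qed auto

section \<open>Edmonds' condition and the induction on root sets\<close>

definition indeg :: "'a set \<Rightarrow> ('a \<Rightarrow> 'v) \<Rightarrow> ('a \<Rightarrow> 'v set) \<Rightarrow> 'v set \<Rightarrow> nat" where
  "indeg S h W X = card {a \<in> S. h a \<in> X \<and> \<not> W a \<subseteq> X}"

lemma indeg_submodular:
  assumes "finite S" "\<And>a. a \<in> S \<Longrightarrow> h a \<in> W a"
  shows "indeg S h W (X \<inter> Y) + indeg S h W (X \<union> Y) \<le> indeg S h W X + indeg S h W Y"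
proof -
  let ?i = "\<lambda>Z a. of_bool (h a \<in> Z \<and> \<not> W a \<subseteq> Z) :: nat"
  have eq: "indeg S h W Z = (\<Sum>a\<in>S. ?i Z a)" for Z
    using assms(1) by (simp add: indeg_def Int_def)
  have "?i (X \<inter> Y) a + ?i (X \<union> Y) a \<le> ?i X a + ?i Y a" if "a \<in> S" for a
    by (cases "W a \<subseteq> X"; cases "W a \<subseteq> Y") (use assms(2)[OF that] in \<open>auto simp: of_bool_def\<close>)
  then show ?thesis unfolding eq sum.distrib[symmetric] by (rule sum_mono)
qed

text \<open>The number of branchings that still have to enter \<open>X\<close>, the demand side of
  Edmonds' condition.\<close>

definition avoiding :: "nat \<Rightarrow> (nat \<Rightarrow> 'v set) \<Rightarrow> 'v set \<Rightarrow> nat" where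
  "avoiding k R X = card {i. i < k \<and> R i \<inter> X = {}}"

lemma avoiding_sum: "avoiding k R X = (\<Sum>i<k. of_bool (R i \<inter> X = {}))"
proof -
  have "{i. i < k \<and> R i \<inter> X = {}} = {..<k} \<inter> {i. R i \<inter> X = {}}" by auto
  then show ?thesis by (simp add: avoiding_def)
qed

text \<open>Supermodularity holds index by index. The index \<open>i\<close> contributes nothing on
  the left, so its possible contribution for the intersection is left over as a surplus; this later
  shows that an intersection of tight sets still meets \<open>R i\<close>.\<close>

lemma avoiding_supermodular:
  assumes "i < k" "X \<inter> R i \<noteq> {}" "Y \<inter> R i \<noteq> {}"
  shows "avoiding k R X + avoiding k R Y + of_bool (R i \<inter> (X \<inter> Y) = {})
    \<le> avoiding k R (X \<inter> Y) + avoiding k R (X \<union> Y)"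
proof -
  let ?b = "\<lambda>X j. of_bool (R j \<inter> X = {}) :: nat"
  have "avoiding k R X + avoiding k R Y = (\<Sum>j\<in>{..<k} - {i}. ?b X j + ?b Y j)"
    using assms by (simp add: avoiding_sum sum.remove[of "{..<k}" i] sum.distrib Int_commute del: sum_of_bool_eq)
  also have "\<dots> \<le> (\<Sum>j\<in>{..<k} - {i}. ?b (X \<inter> Y) j + ?b (X \<union> Y) j)"
    by (rule sum_mono) (auto simp: of_bool_def)
  also have "\<dots> + ?b (X \<inter> Y) i \<le> avoiding k R (X \<inter> Y) + avoiding k R (X \<union> Y)"
    using assms by (simp add: avoiding_sum sum.remove[of "{..<k}" i] sum.distrib del: sum_of_bool_eq)
  finally show ?thesis by simp
qed

text \<open>
  Lovasz's choice: any edge entering \<open>X - R i\<close> but not \<open>X\<close>, for a minimal tight set \<open>X\<close> that meets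
  both \<open>R i\<close> and its complement (the set \<open>V\<close> is always tight).
\<close>
lemma safe_edge:
  assumes fin: "finite V" "finite S" and SV: "\<And>a. a \<in> S \<Longrightarrow> h a \<in> W a \<and> W a \<subseteq> V"
    and R: "R i \<subseteq> V" "R i \<noteq> {}" "R i \<noteq> V" and i: "i < k" and RV: "\<And>j. j < k \<Longrightarrow> R j \<inter> V \<noteq> {}"
    and cond: "\<And>X. X \<subseteq> V \<Longrightarrow> X \<noteq> {} \<Longrightarrow> avoiding k R X \<le> indeg S h W X"
  shows "\<exists>a\<in>S. W a \<inter> R i \<noteq> {} \<and> h a \<in> V - R i \<and>
    (\<forall>X\<subseteq>V. X \<noteq> {} \<longrightarrow>
       avoiding k (R(i := insert (h a) (R i))) X \<le> indeg (S - {a}) h W X)"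
proof -
  let ?T = "\<lambda>X. X \<subseteq> V \<and> X \<inter> R i \<noteq> {} \<and> X - R i \<noteq> {} \<and> avoiding k R X = indeg S h W X"
  have "{a \<in> S. h a \<in> V \<and> \<not> W a \<subseteq> V} = {}" using SV by blast
  then have "indeg S h W V = 0" unfolding indeg_def by (metis card.empty)
  moreover have "{i. i < k \<and> R i \<inter> V = {}} = {}" using RV by blast
  then have "avoiding k R V = 0" unfolding avoiding_def by (metis card.empty)
  ultimately have "?T V" using R by auto
  then obtain X where X: "?T X" and min: "\<And>Y. ?T Y \<Longrightarrow> card X \<le> card Y"
    using ex_has_least_nat[of ?T V card] by blast
  have finX: "finite X" using X fin finite_subset by blast
  \<comment> \<open>Removing \<open>R i\<close> from \<open>X\<close> makes \<open>i\<close> itself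
    newly avoiding. As \<open>X\<close> is tight, more edges enter \<open>X - R i\<close> than
    \<open>X\<close>, and one entering only the former lies inside \<open>X\<close> and meets
    \<open>R i\<close>.\<close>
  have "avoiding k R X < avoiding k R (X - R i)"
    unfolding avoiding_def using X i by (intro psubset_card_mono) auto
  also have "\<dots> \<le> indeg S h W (X - R i)" using X by (intro cond) auto
  finally have lt: "indeg S h W X < indeg S h W (X - R i)" using X by simp
  have "\<not> {a \<in> S. h a \<in> X - R i \<and> \<not> W a \<subseteq> X - R i} \<subseteq> {a \<in> S. h a \<in> X \<and> \<not> W a \<subseteq> X}"
    (is "\<not> ?N \<subseteq> ?M")
  proof
    assume "?N \<subseteq> ?M"
    then have "card ?N \<le> card ?M" using fin(2) by (intro card_mono) auto
    then show False using lt unfolding indeg_def by simp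
  qed
  then obtain a where a: "a \<in> S" "h a \<in> X - R i" "\<not> W a \<subseteq> X - R i" "W a \<subseteq> X" by blast
  let ?R = "R(i := insert (h a) (R i))"
  have "avoiding k ?R Y \<le> indeg (S - {a}) h W Y" if Y: "Y \<subseteq> V" "Y \<noteq> {}" for Y
  proof -
    have ind: "indeg S h W Y = of_bool (h a \<in> Y \<and> \<not> W a \<subseteq> Y) + indeg (S - {a}) h W Y"
    proof -
      have eq: "{b \<in> S. h b \<in> Y \<and> \<not> W b \<subseteq> Y} = 
        (if h a \<in> Y \<and> \<not> W a \<subseteq> Y then insert a {b \<in> S - {a}. h b \<in> Y \<and> \<not> W b \<subseteq> Y}
         else {b \<in> S - {a}. h b \<in> Y \<and> \<not> W b \<subseteq> Y})" using a(1) by auto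
      show ?thesis unfolding indeg_def eq using fin(2) by simp
    qed
    have av: "avoiding k R Y = avoiding k ?R Y + of_bool (h a \<in> Y \<and> R i \<inter> Y = {})"
    proof -
      have "(\<Sum>j\<in>{..<k} - {i}. of_bool (?R j \<inter> Y = {})) =
        (\<Sum>j\<in>{..<k} - {i}. of_bool (R j \<inter> Y = {}) :: nat)"
        by (rule sum.cong) auto
      then show ?thesis
        using i by (simp add: avoiding_sum sum.remove[of "{..<k}" i] del: sum_of_bool_eq)
    qed
    have c: "avoiding k R Y \<le> indeg S h W Y" using cond Y by blast
    show ?thesis
    proof (rule ccontr)
      assume "\<not> ?thesis"
      \<comment> \<open>Deleting \<open>a\<close> costs \<open>Y\<close> at most one entering edge,
        so a violation requires that \<open>a\<close> enters \<open>Y\<close>, that \<open>Y\<close>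
        was tight, and that enlarging \<open>R i\<close> did not lower the demand, so
        \<open>R i\<close> already met \<open>Y\<close>.\<close>
      then have bad: "h a \<in> Y" "\<not> W a \<subseteq> Y" "Y \<inter> R i \<noteq> {}" "avoiding k R Y = indeg S h W Y"
        using ind av c by (auto simp: of_bool_def split: if_splits)
      have XY: "X \<inter> Y \<noteq> {}" "X \<inter> Y \<subseteq> V" "X \<union> Y \<subseteq> V" "X \<union> Y \<noteq> {}"
        using a bad X Y by auto
      have "avoiding k R X + avoiding k R Y + of_bool (R i \<inter> (X \<inter> Y) = {})
          \<le> avoiding k R (X \<inter> Y) + avoiding k R (X \<union> Y)"
        by (rule avoiding_supermodular[OF i]) (use X bad(3) in simp_all)
      moreover have "indeg S h W (X \<inter> Y) + indeg S h W (X \<union> Y) \<le> indeg S h W X + indeg S h W Y"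
        by (rule indeg_submodular[OF fin(2)]) (use SV in blast)
      moreover have "avoiding k R X = indeg S h W X" using X by blast
      \<comment> \<open>All inequalities are squeezed, so \<open>X \<inter> Y\<close> is tight and
        meets \<open>R i\<close>. It is smaller than \<open>X\<close> because \<open>W a\<close>
        lies in \<open>X\<close> but not in \<open>Y\<close>, contradicting minimality.\<close>
      ultimately have "of_bool (R i \<inter> (X \<inter> Y) = {}) = (0::nat)"
          "avoiding k R (X \<inter> Y) = indeg S h W (X \<inter> Y)"
        using bad(4) cond[OF XY(2,1)] cond[OF XY(3,4)] by linarith+
      then have "?T (X \<inter> Y)" using XY a bad by (auto simp: of_bool_def split: if_splits)
      then have "card X \<le> card (X \<inter> Y)" using min by blast
      moreover have "card (X \<inter> Y) < card X"
        using finX a bad by (intro psubset_card_mono) auto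
      ultimately show False by simp
    qed
  qed
  moreover have "W a \<inter> R i \<noteq> {}" using a by blast
  moreover have "h a \<in> V - R i" using a X by blast
  ultimately show ?thesis using a(1) by blast
qed

text \<open>Induction on the number of vertices still missing from all root sets together. A safe
  edge is put first in branching \<open>i\<close> and deleted from \<open>S\<close>, which keeps the
  branchings disjoint.\<close>

lemma disjoint_branchings:
  assumes "finite V" "finite S" "\<And>a. a \<in> S \<Longrightarrow> h a \<in> W a \<and> W a \<subseteq> V"
    and "\<And>j. j < k \<Longrightarrow> R j \<subseteq> V \<and> R j \<noteq> {}"
    and "\<And>X. X \<subseteq> V \<Longrightarrow> X \<noteq> {} \<Longrightarrow> avoiding k R X \<le> indeg S h W X"
  shows "\<exists>B. disjoint_family_on B {..<k} \<and> (\<forall>i<k. B i \<subseteq> S \<and> spans V h W (R i) (B i))"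
  using assms(2-)
proof (induction "\<Sum>i<k. card (V - R i)" arbitrary: S R rule: less_induct)
  case less
  show ?case
  proof (cases "\<forall>i<k. R i = V")
    case True
    then show ?thesis
      by (intro exI[of _ "\<lambda>_. {}"]) (auto simp: disjoint_family_on_def intro: spans.full)
  next
    case False
    then obtain i where i: "i < k" "R i \<noteq> V" by blast
    have "\<exists>a\<in>S. W a \<inter> R i \<noteq> {} \<and> h a \<in> V - R i \<and>
      (\<forall>X\<subseteq>V. X \<noteq> {} \<longrightarrow>
         avoiding k (R(i := insert (h a) (R i))) X \<le> indeg (S - {a}) h W X)"
      by (rule safe_edge[OF assms(1) less.prems(1)]) (use less.prems i in \<open>auto simp: Int_absorb2\<close>)
    then obtain a where a: "a \<in> S" "W a \<inter> R i \<noteq> {}" "h a \<in> V - R i"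
      "\<And>X. X \<subseteq> V \<Longrightarrow> X \<noteq> {} \<Longrightarrow>
         avoiding k (R(i := insert (h a) (R i))) X \<le> indeg (S - {a}) h W X" by blast
    let ?R = "R(i := insert (h a) (R i))"
    have "(\<Sum>j<k. card (V - ?R j)) < (\<Sum>j<k. card (V - R j))"
    proof (rule sum_strict_mono_ex1)
      show "\<forall>j\<in>{..<k}. card (V - ?R j) \<le> card (V - R j)"
        using assms(1) by (auto intro!: card_mono)
      have "card (V - ?R i) < card (V - R i)"
        using a assms(1) by (intro psubset_card_mono) auto
      then show "\<exists>j\<in>{..<k}. card (V - ?R j) < card (V - R j)" using i by blast
    qed simp
    moreover have "?R j \<subseteq> V \<and> ?R j \<noteq> {}" if "j < k" for j using less.prems(3)[OF that] a by auto
    moreover have "finite (S - {a})" using less.prems by simp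
    moreover have "h b \<in> W b \<and> W b \<subseteq> V" if "b \<in> S - {a}" for b using less.prems(2) that by blast
    ultimately have "\<exists>B. disjoint_family_on B {..<k} \<and>
        (\<forall>j<k. B j \<subseteq> S - {a} \<and> spans V h W (?R j) (B j))"
      using a(4) by (intro less.hyps) 
    then obtain B where B: "disjoint_family_on B {..<k}"
      "\<And>j. j < k \<Longrightarrow> B j \<subseteq> S - {a} \<and> spans V h W (?R j) (B j)" by blast
    let ?B = "B(i := insert a (B i))"
    have "disjoint_family_on ?B {..<k}"
      using B i unfolding disjoint_family_on_def by (auto; blast)
    moreover have "?B j \<subseteq> S \<and> spans V h W (R j) (?B j)" if "j < k" for j
    proof (cases "j = i")
      case True
      have "spans V h W (insert (h a) (R i)) (B i)" "a \<notin> B i" using B(2)[OF i(1)] by auto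
      then show ?thesis using True a B(2)[OF i(1)] spans.step[of V h W a "R i" "B i"] by auto
    qed (use B(2)[OF that] in auto)
    ultimately show ?thesis by blast
  qed
qed

section \<open>Arborescences and ranks\<close>

lemma underlying_cycle_of_cycle:
  assumes "wf_digraph D" "pre_digraph.cycle D p"
  shows "underlying_cycle D (map (\<lambda>a. (a, True)) p)"
proof -
  interpret wf_digraph D by fact
  let ?G = "both_orientations D" and ?q = "map (\<lambda>a. (a, True)) p"
  obtain u where u: "awalk u p u" "distinct (tl (awalk_verts u p))" "distinct p" "p \<noteq> []"
    using assms(2) unfolding cycle_conv by blast
  have v: "pre_digraph.awalk_verts ?G u (map (\<lambda>a. (a, True)) q) = awalk_verts u q" for u q
    by (induction q arbitrary: u) (simp_all add: pre_digraph.awalk_verts.simps both_orientations_def)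
  have c: "pre_digraph.cas ?G u (map (\<lambda>a. (a, True)) q) w = cas u q w" for u q w
    by (induction q arbitrary: u) (simp_all add: pre_digraph.cas.simps both_orientations_def)
  have "pre_digraph.awalk ?G u ?q u"
    using u(1) unfolding pre_digraph.awalk_def c by (auto simp: both_orientations_def)
  then show ?thesis
    using u(2-) by (auto simp: underlying_cycle_def pre_digraph.cycle_def v o_def)
qed

text \<open>A directed cycle, traversed forward, would be an underlying cycle, so the finite arc
  relation is well-founded. A minimal vertex of \<open>X\<close> differs from \<open>r\<close>, and
  its entering arc starts outside \<open>X\<close>.\<close>

lemma arborescence_entering:
  assumes D: "arborescence D r" and X: "X \<subseteq> verts D" "X \<noteq> {}" "r \<notin> X"
  shows "\<exists>a\<in>arcs D. head D a \<in> X \<and> tail D a \<notin> X"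
proof -
  interpret fin_digraph D using D by (simp add: arborescence_def)
  have "acyclic (arcs_ends D)"
  proof (rule acyclicI, rule allI, rule notI)
    fix x assume "(x, x) \<in> (arcs_ends D)\<^sup>+"
    then obtain p where "awalk x p x" "p \<noteq> []" unfolding reachable1_awalk by blast
    then have "closed_w p" by (auto simp: closed_w_def)
    then obtain q where "cycle q" using closed_w_imp_cycle by blast
    then show False using underlying_cycle_of_cycle[OF wf_digraph] D
      by (auto simp: arborescence_def underlying_tree_def)
  qed
  moreover have "finite (arcs_ends D)" by (simp add: arcs_ends_conv)
  ultimately have "wf (arcs_ends D)" by (rule finite_acyclic_wf[rotated])
  then obtain v where v: "v \<in> X" "\<And>u. (u, v) \<in> arcs_ends D \<Longrightarrow> u \<notin> X"
    using X(2) wfE_min' by (metis wf_eq_minimal ex_in_conv)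
  then have "in_degree D v = 1" using D X by (auto simp: arborescence_def)
  then have "in_arcs D v \<noteq> {}" by (auto simp: in_degree_def)
  then obtain a where "a \<in> arcs D" "head D a = v" by (auto simp: in_arcs_def)
  then show ?thesis using v by (auto simp: arcs_ends_conv)
qed

text \<open>
  As every vertex is the head of at most one arc, an underlying walk without repeated arcs that has
  gone forward once never goes backward again.
\<close>
lemma ranked_no_underlying_cycle:
  fixes \<rho> :: "'v \<Rightarrow> nat"
  assumes inj: "inj_on (head D) (arcs D)"
    and rank: "\<And>a. a \<in> arcs D \<Longrightarrow> \<rho> (tail D a) < \<rho> (head D a)"
  shows "\<not> underlying_cycle D p"
proof
  let ?G = "both_orientations D"
  let ?cas = "pre_digraph.cas ?G"
  assume "underlying_cycle D p"
  then obtain u where p: "?cas u p u" "set p \<subseteq> arcs ?G" "distinct (map fst p)" "p \<noteq> []"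
    by (auto simp: underlying_cycle_def pre_digraph.cycle_def pre_digraph.awalk_def)
  have arcs: "arcs ?G = arcs D \<times> UNIV" by (simp add: both_orientations_def)
  have hd: "head ?G (a, b) = (if b then head D a else tail D a)"
    and tl: "tail ?G (a, b) = (if b then tail D a else head D a)" for a b
    by (simp_all add: both_orientations_def)
  have cas_Cons: "?cas u (e # q) w \<longleftrightarrow> tail ?G e = u \<and> ?cas (head ?G e) q w"
    and cas_Nil: "?cas u [] w \<longleftrightarrow> u = w" for u e q w
    by (simp_all add: pre_digraph.cas.simps)
  note cas = cas_Cons cas_Nil hd tl
  have forward: "\<rho> u < \<rho> w \<and> snd (last q)"
    if "?cas u q w" "set q \<subseteq> arcs ?G" "distinct (map fst q)" "q \<noteq> []" "snd (hd q)" for u q w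
    using that
  proof (induction q arbitrary: u)
    case (Cons e q)
    obtain a where e: "e = (a, True)" "a \<in> arcs D" using Cons.prems arcs by (cases e) auto
    have "\<rho> (tail D a) < \<rho> (head D a)" using rank e by blast
    moreover have "\<rho> (head D a) < \<rho> w \<and> snd (last q)" if ne: "q \<noteq> []"
    proof -
      obtain b d q' where q: "q = (b, d) # q'" using ne by (cases q) auto
      have b: "b \<in> arcs D" "b \<noteq> a" using Cons.prems q e arcs by auto
      have "d"
      proof (rule ccontr)
        assume "\<not> d"
        then have "head D b = head D a" using Cons.prems q e by (simp add: cas)
        then show False using inj e b by (auto dest: inj_onD)
      qed
      then show ?thesis using Cons.prems e q by (intro Cons.IH) (auto simp: cas)
    qed
    ultimately show ?case using Cons.prems e by (cases q) (auto simp: cas)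
  qed simp
  have backward: "\<rho> w < \<rho> u"
    if "?cas u q w" "set q \<subseteq> arcs ?G" "distinct (map fst q)" "q \<noteq> []" "\<not> snd (last q)" for u q w
    using that
  proof (induction q arbitrary: u)
    case (Cons e q)
    \<comment> \<open>By \<open>forward\<close>, a first step taken forward would force the last one
      to be forward.\<close>
    have "\<not> snd e" using forward[OF Cons.prems(1-4)] Cons.prems(5) by auto
    then obtain a where e: "e = (a, False)" "a \<in> arcs D"
      using Cons.prems arcs by (cases e) auto
    have "\<rho> (tail D a) < \<rho> (head D a)" using rank e by blast
    moreover have "\<rho> w < \<rho> (tail D a)" if "q \<noteq> []"
      using Cons.prems e that by (intro Cons.IH) (auto simp: cas)
    ultimately show ?case using Cons.prems e by (cases "q = []") (auto simp: cas)
  qed simp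
  have last_head: "head ?G (last q) = w" if "?cas u q w" "q \<noteq> []" for u q w
    using that by (induction q arbitrary: u) (auto simp: cas_Cons cas_Nil)
  \<comment> \<open>A closed walk can neither raise nor lower the rank, so it starts backward and
    ends forward. Its first and last arcs are then distinct arcs with the same head
    \<open>u\<close>.\<close>
  have first: "\<not> snd (hd p)" and last: "snd (last p)" using forward[OF p] backward[OF p] by auto
  obtain a q where a: "p = (a, False) # q" using p(4) first by (cases p) auto
  obtain b where b: "last p = (b, True)" using last by (cases "last p") auto
  have "q \<noteq> []" using a b by auto
  then have "(b, True) \<in> set q" using a b by (metis last.simps last_in_set)
  then have "b \<in> fst ` set q" by force
  then have "a \<noteq> b" using p(3) a by auto
  moreover have "head D a = u" using p(1) a by (simp add: cas)
  moreover have "head D b = u" using last_head[OF p(1,4)] b by (simp add: cas)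
  moreover have "a \<in> arcs D" "b \<in> arcs D"
    using p(2) a \<open>(b, True) \<in> set q\<close> arcs by auto
  ultimately show False using inj by (auto dest: inj_onD)
qed

text \<open>Following entering arcs backward lowers the rank and can only stop at \<open>r\<close>,
  so every vertex is reachable from \<open>r\<close>; connectivity follows through
  \<open>r\<close>.\<close>

lemma ranked_arborescence:
  fixes \<rho> :: "'v \<Rightarrow> nat"
  assumes D: "fin_digraph D" and r: "r \<in> verts D"
    and inj: "inj_on (head D) (arcs D)" and heads: "head D ` arcs D = verts D - {r}"
    and rank: "\<And>a. a \<in> arcs D \<Longrightarrow> \<rho> (tail D a) < \<rho> (head D a)"
  shows "arborescence D r"
proof -
  interpret fin_digraph D by fact
  interpret sym: pair_wf_digraph "mk_symmetric D" by (rule wellformed_mk_symmetric)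
  have reach: "r \<rightarrow>\<^sup>*\<^bsub>D\<^esub> v" if "v \<in> verts D" for v
    using that
  proof (induction "\<rho> v" arbitrary: v rule: less_induct)
    case less
    show ?case
    proof (cases "v = r")
      case False
      then have "v \<in> head D ` arcs D" using heads less.prems by simp
      then obtain a where a: "a \<in> arcs D" "head D a = v" by blast
      then have "r \<rightarrow>\<^sup>*\<^bsub>D\<^esub> tail D a" using rank[OF a(1)] by (intro less.hyps) auto
      moreover have "tail D a \<rightarrow>\<^bsub>D\<^esub> v" using a by (auto simp: arcs_ends_conv)
      ultimately show ?thesis by (rule reachable_adj_trans)
    qed (use r in auto)
  qed
  have "u \<rightarrow>\<^sup>*\<^bsub>mk_symmetric D\<^esub> v" if "u \<in> verts D" "v \<in> verts D" for u v
  proof -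
    have "r \<rightarrow>\<^sup>*\<^bsub>mk_symmetric D\<^esub> u" "r \<rightarrow>\<^sup>*\<^bsub>mk_symmetric D\<^esub> v"
      using that reach reachable_mk_symmetricI by auto
    then show ?thesis
      by (rule sym.reachable_trans[OF symmetric_reachable[OF symmetric_mk_symmetric]])
  qed
  then have "Digraph_Component.connected D"
    using r by (auto simp: connected_def strongly_connected_def)
  moreover have "in_degree D v = 1" if "v \<in> verts D - {r}" for v
  proof -
    have "v \<in> head D ` arcs D" using heads that by simp
    then obtain a where "a \<in> arcs D" "head D a = v" by blast
    then have "in_arcs D v = {a}" using inj by (auto simp: in_arcs_def dest: inj_onD)
    then show ?thesis by (simp add: in_degree_def)
  qed
  ultimately show ?thesis
    using D r ranked_no_underlying_cycle[OF inj rank] by (auto simp: arborescence_def underlying_tree_def)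
qed

section \<open>Packings\<close>

definition heads :: "('v, 'd, 'e) mixed_hgraph \<Rightarrow> 'd + 'e \<Rightarrow> 'v set" where
  "heads F = case_sum (\<lambda>a. {dhead F a}) (hends F)"

definition ends :: "('v, 'd, 'e) mixed_hgraph \<Rightarrow> 'd + 'e \<Rightarrow> 'v set" where
  "ends F = case_sum (\<lambda>a. insert (dhead F a) (dtail F a)) (hends F)"

definition edges :: "('v, 'd, 'e) mixed_hgraph \<Rightarrow> ('d + 'e) set" where
  "edges F = dyperedges F <+> hyperedges F"

lemma heads_simps [simp]:
  "heads F (Inl a) = {dhead F a}" "heads F (Inr e) = hends F e"
  "ends F (Inl a) = insert (dhead F a) (dtail F a)" "ends F (Inr e) = hends F e"
  by (simp_all add: heads_def ends_def)

lemma (in mixed_hypergraph) edge_props: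
  assumes "x \<in> edges F"
  shows "heads F x \<noteq> {}" "heads F x \<subseteq> ends F x" "ends F x \<subseteq> vertices F"
  using assms dhead_in dtail_subset hends_subset hends_card
  by (fastforce simp: edges_def)+

lemma (in mixed_hypergraph) finite_edges: "finite (edges F)"
  by (simp add: edges_def finite_dyperedges finite_hyperedges)

text \<open>By disjointness, a member containing all ends of an edge is the only member that the
  edge can meet; hence not lying inside the member met is the same as not lying inside any
  member.\<close>

lemma (in mixed_hypergraph) entering_number_eq:
  assumes P: "subpartition (vertices F) P"
  shows "entering_number F P = cross_num (edges F) (heads F) (ends F) P"
proof -
  let ?E = "\<Union>X\<in>P. hyperedge_cut F X" and ?D = "\<Union>X\<in>P. dyperedge_in_cut F X"
  have disj: "X = Y" if "X \<in> P" "Y \<in> P" "x \<in> X" "x \<in> Y" for X Y x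
    using P that unfolding subpartition_def disjoint_def by blast
  have D: "a \<in> ?D \<longleftrightarrow> a \<in> dyperedges F \<and> crosses (heads F (Inl a)) (ends F (Inl a)) P" for a
    using disj by (fastforce simp: dyperedge_in_cut_def crosses_def)
  have E: "e \<in> ?E \<longleftrightarrow> e \<in> hyperedges F \<and> crosses (heads F (Inr e)) (ends F (Inr e)) P" for e
  proof -
    have "(\<exists>X\<in>P. hends F e \<inter> X \<noteq> {} \<and> hends F e - X \<noteq> {}) \<longleftrightarrow> crosses (hends F e) (hends F e) P"
      using disj unfolding crosses_def by blast
    then show ?thesis by (auto simp: hyperedge_cut_def)
  qed
  have "{a \<in> edges F. crosses (heads F a) (ends F a) P} = ?D <+> ?E" (is "?L = ?R")
  proof (rule set_eqI)
    show "x \<in> ?L \<longleftrightarrow> x \<in> ?R" for x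
      using D E by (cases x) (auto simp: edges_def simp del: UN_iff)
  qed
  moreover have "finite ?D" by (rule finite_subset[OF _ finite_dyperedges]) (use D in blast)
  moreover have "finite ?E" by (rule finite_subset[OF _ finite_hyperedges]) (use E in blast)
  ultimately show ?thesis
    unfolding entering_number_def cross_num_def by (simp add: card_Plus)
qed

lemma spanning_hyperarborescenceI:
  assumes F: "mixed_hypergraph F" and B: "B \<subseteq> edges F" and h: "\<And>a. a \<in> B \<Longrightarrow> h a \<in> heads F a"
    and r: "r \<in> vertices F" and sp: "spans (vertices F) h (ends F) {r} B"
  shows "spanning_hyperarborescence F r (Inl -` B) (Inr -` B)"
proof -
  interpret mixed_hypergraph F by fact
  obtain t and \<rho> :: "'a \<Rightarrow> nat" where t: "inj_on h B" "h ` B = vertices F - {r}"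
    "\<And>a. a \<in> B \<Longrightarrow> t a \<in> ends F a \<and> t a \<in> vertices F \<and> \<rho> (t a) < \<rho> (h a)"
    using spans_rank[OF sp] by meson
  let ?D = "\<lparr>verts = vertices F, arcs = B, tail = t, head = h\<rparr>"
  have tr: "trimming (F\<lparr>dyperedges := Inl -` B, hyperedges := Inr -` B\<rparr>) ?D"
  proof -
    have "B = (Inl -` B) <+> (Inr -` B)" 
      by (rule set_eqI, case_tac x) auto
    \<comment> \<open>The strict increase of rank separates tail and head: the tail of a dyperedge
      must come from \<open>dtail\<close>, and a hyperedge is not trimmed to a loop.\<close>
    moreover have "t (Inl a) \<in> dtail F a" if "Inl a \<in> B" for a
      using t(3)[OF that] h[OF that] by auto
    moreover have "t (Inr e) \<noteq> h (Inr e)" if "Inr e \<in> B" for e using t(3)[OF that] by auto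
    ultimately show ?thesis using t(3) h by (fastforce simp: trimming_def)
  qed
  have hV: "h a \<in> vertices F" if "a \<in> B" for a using t(2) that by blast
  have "fin_digraph ?D"
    using t(3) hV finite_vertices finite_subset[OF B finite_edges] by unfold_locales auto
  then have "arborescence ?D r"
    using t r by (intro ranked_arborescence[where \<rho> = \<rho>]) auto
  moreover have "Inl -` B \<subseteq> dyperedges F" "Inr -` B \<subseteq> hyperedges F"
    using B by (auto simp: edges_def)
  ultimately show ?thesis unfolding spanning_hyperarborescence_def using r tr by blast
qed

text \<open>Every member avoiding \<open>r\<close> is entered by an arc. These arcs have heads in
  disjoint sets, so they come from different edges, and at most one member contains
  \<open>r\<close>.\<close>

lemma hyperarborescence_crosses:
  assumes F: "mixed_hypergraph F" and sp: "spanning_hyperarborescence F r A E"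
    and P: "subpartition (vertices F) P"
  shows "card P \<le> cross_num (A <+> E) (heads F) (ends F) P + of_bool (r \<in> \<Union>P)"
proof -
  interpret mixed_hypergraph F by fact
  obtain D where D: "trimming (F\<lparr>dyperedges := A, hyperedges := E\<rparr>) D" "arborescence D r"
    and AE: "A \<subseteq> dyperedges F" "E \<subseteq> hyperedges F"
    using sp unfolding spanning_hyperarborescence_def by blast
  have verts: "verts D = vertices F" and arcs: "arcs D = A <+> E"
    using D(1) by (auto simp: trimming_def)
  have trim: "head D a \<in> heads F a \<and> head D a \<in> ends F a \<and> tail D a \<in> ends F a" if "a \<in> A <+> E" for a
    using D(1) that by (cases a) (auto simp: trimming_def)
  have disj: "X = Y" if "X \<in> P" "Y \<in> P" "x \<in> X" "x \<in> Y" for X Y x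
    using P that unfolding subpartition_def disjoint_def by blast
  have finP: "finite P" using finite_subpartition[OF finite_vertices P] .
  let ?P = "{X \<in> P. r \<notin> X}"
  have "\<exists>a\<in>arcs D. head D a \<in> X \<and> tail D a \<notin> X" if "X \<in> ?P" for X
    using that P by (intro arborescence_entering[OF D(2)]) (auto simp: verts subpartition_def)
  then obtain a where a: "\<And>X. X \<in> ?P \<Longrightarrow> a X \<in> A <+> E \<and> head D (a X) \<in> X \<and> tail D (a X) \<notin> X"
    unfolding arcs by metis
  have "inj_on a ?P"
  proof (rule inj_onI)
    fix X Y assume "X \<in> ?P" "Y \<in> ?P" "a X = a Y"
    then show "X = Y" using a[of X] a[of Y] disj[of X Y] by auto
  qed
  moreover have "a ` ?P \<subseteq> {a \<in> A <+> E. crosses (heads F a) (ends F a) P}"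
  proof (intro image_subsetI CollectI conjI)
    fix X assume X: "X \<in> ?P"
    have aX: "a X \<in> A <+> E" "head D (a X) \<in> X" "tail D (a X) \<notin> X" using a[OF X] by auto
    then have ends: "head D (a X) \<in> heads F (a X)" "tail D (a X) \<in> ends F (a X)"
        "head D (a X) \<in> ends F (a X)"
      using trim by auto
    show "a X \<in> A <+> E" by fact
    have "\<not> ends F (a X) \<subseteq> Y" if "Y \<in> P" for Y
    proof
      assume sub: "ends F (a X) \<subseteq> Y"
      then have "X = Y" using aX ends X that by (intro disj[of X Y "head D (a X)"]) auto
      moreover have "tail D (a X) \<in> Y" using sub ends by blast
      ultimately show False using aX by simp
    qed
    moreover have "head D (a X) \<in> heads F (a X) \<inter> \<Union>P" using aX ends X by auto
    ultimately show "crosses (heads F (a X)) (ends F (a X)) P" unfolding crosses_def by blast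
  qed
  moreover have "finite (A <+> E)"
    using AE by (simp add: finite_subset[OF _ finite_dyperedges] finite_subset[OF _ finite_hyperedges])
  ultimately have "card ?P \<le> cross_num (A <+> E) (heads F) (ends F) P"
    unfolding cross_num_def by (intro card_inj_on_le) auto
  moreover have "card P \<le> card ?P + of_bool (r \<in> \<Union>P)"
  proof (cases "r \<in> \<Union>P")
    case True
    then obtain X where "X \<in> P" "r \<in> X" by blast
    then have "P \<subseteq> insert X ?P" using disj by blast
    then have "card P \<le> card (insert X ?P)" using finP by (intro card_mono) auto
    also have "\<dots> \<le> card ?P + 1" using card_insert_le_m1[of "card ?P + 1" ?P X] by simp
    finally show ?thesis using True by simp
  next
    case False
    then have "?P = P" by blast
    then show ?thesis by simp
  qed
  ultimately show ?thesis by simp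
qed

lemma card_preimage:
  assumes "finite X"
  shows "card {i. i < k \<and> r i \<in> X} = (\<Sum>v\<in>X. card {i. i < (k::nat) \<and> r i = v})"
proof -
  have "{i. i < k \<and> r i \<in> X} = (\<Union>v\<in>X. {i. i < k \<and> r i = v})" by auto
  then show ?thesis using assms by (simp only:) (rule card_UN_disjoint, auto)
qed

lemma family_with_multiplicities:
  fixes m :: "'v \<Rightarrow> nat"
  assumes "finite V"
  shows "\<exists>r. (\<forall>i<sum m V. r i \<in> V) \<and> (\<forall>v\<in>V. card {i. i < sum m V \<and> r i = v} = m v)"
  using assms
proof (induction V rule: finite_induct)
  case (insert v V)
  then obtain r where r: "\<forall>i<sum m V. r i \<in> V" "\<forall>v\<in>V. card {i. i < sum m V \<and> r i = v} = m v"
    by blast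
  let ?r = "\<lambda>i. if i < sum m V then r i else v"
  have s: "sum m (insert v V) = sum m V + m v" using insert by simp
  have "{i. i < sum m (insert v V) \<and> ?r i = v} = {sum m V..<sum m V + m v}"
  proof (rule set_eqI)
    fix i
    have "r i \<noteq> v" if "i < sum m V" using r(1) insert.hyps(2) that by blast
    then show "i \<in> {i. i < sum m (insert v V) \<and> ?r i = v} \<longleftrightarrow> i \<in> {sum m V..<sum m V + m v}"
      using s by (cases "i < sum m V") auto
  qed
  moreover have "{i. i < sum m (insert v V) \<and> ?r i = u} = {i. i < sum m V \<and> r i = u}" if "u \<in> V" for u
    using that insert.hyps(2) s by auto
  ultimately show ?case using r by (intro exI[of _ ?r]) auto
qed auto

text \<open>The crossing counts of the single hyperarborescences add up because these are
  edge-disjoint. Keeping the actual number of roots in \<open>\<Union>P\<close> gives a common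
  source for both families of inequalities.\<close>

lemma flexible_packing_necessary:
  assumes F: "mixed_hypergraph F" and pack: "flexible_packing F k f g r A E"
    and P: "subpartition (vertices F) P"
  shows "k * card P \<le> entering_number F P + card {i. i < k \<and> r i \<in> \<Union>P}"
proof -
  interpret mixed_hypergraph F by fact
  have sp: "\<And>i. i < k \<Longrightarrow> spanning_hyperarborescence F (r i) (A i) (E i)"
    and dA: "disjoint_family_on A {..<k}" and dE: "disjoint_family_on E {..<k}"
    using pack by (auto simp: flexible_packing_def hyperarborescence_packing_def)
  let ?C = "\<lambda>i. {a \<in> A i <+> E i. crosses (heads F a) (ends F a) P}"
  have sub: "A i <+> E i \<subseteq> edges F" if "i < k" for i
    using sp[OF that] by (auto simp: edges_def spanning_hyperarborescence_def)
  have "k * card P = (\<Sum>i<k. card P)" by simp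
  also have "\<dots> \<le> (\<Sum>i<k. card (?C i) + of_bool (r i \<in> \<Union>P))"
    using hyperarborescence_crosses[OF F sp P] by (intro sum_mono) (simp add: cross_num_def)
  also have "\<dots> = (\<Sum>i<k. card (?C i)) + card {i. i < k \<and> r i \<in> \<Union>P}"
    by (simp add: sum.distrib lessThan_def Collect_conj_eq)
  also have "(\<Sum>i<k. card (?C i)) = card (\<Union>i<k. ?C i)"
  proof (rule card_UN_disjoint[symmetric])
    show "\<forall>i\<in>{..<k}. finite (?C i)"
      using finite_subset[OF sub finite_edges] by auto
    show "\<forall>i\<in>{..<k}. \<forall>j\<in>{..<k}. i \<noteq> j \<longrightarrow> ?C i \<inter> ?C j = {}"
    proof (intro ballI impI)
      fix i j assume "i \<in> {..<k}" "j \<in> {..<k}" "i \<noteq> j"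
      then have "A i \<inter> A j = {}" "E i \<inter> E j = {}"
        using dA dE unfolding disjoint_family_on_def by auto
      then show "?C i \<inter> ?C j = {}" by auto
    qed
  qed simp
  also have "\<dots> \<le> entering_number F P"
    unfolding entering_number_eq[OF P] cross_num_def
    using sub finite_edges by (intro card_mono) auto
  finally show ?thesis by simp
qed

lemma flexible_packing_exists:
  assumes F: "mixed_hypergraph F" and fg: "\<And>v. v \<in> vertices F \<Longrightarrow> f v \<le> g v"
    and lower: "\<And>P. subpartition (vertices F) P \<Longrightarrow>
      k * card P + sum f (vertices F - \<Union>P) \<le> entering_number F P + k"
    and upper: "\<And>P. subpartition (vertices F) P \<Longrightarrow>
      k * card P \<le> entering_number F P + sum g (\<Union>P)"
  shows "\<exists>r A E. flexible_packing F k f g r A E"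
proof -
  interpret mixed_hypergraph F by fact
  let ?V = "vertices F" and ?S = "edges F" and ?W = "ends F"
  note fin = finite_vertices finite_edges
  have H: "heads F a \<noteq> {} \<and> heads F a \<subseteq> ?W a" if "a \<in> ?S" for a using edge_props[OF that] by blast
  have "demand_met ?V ?S (heads F) ?W k g"
    using upper entering_number_eq by (simp add: demand_met_def)
  then have "\<exists>m. (\<forall>v\<in>?V. f v \<le> m v \<and> m v \<le> g v) \<and> sum m ?V = k \<and>
      demand_met ?V ?S (heads F) ?W k m"
    using H fg lower vertices_nonempty edge_props(3)
    by (intro root_vector[OF fin]) (simp_all add: entering_number_eq)
  then obtain m where m: "\<forall>v\<in>?V. f v \<le> m v \<and> m v \<le> g v" "sum m ?V = k"
    "demand_met ?V ?S (heads F) ?W k m" by blast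
  obtain h where h: "\<And>a. a \<in> ?S \<Longrightarrow> h a \<in> heads F a" "demand_met ?V ?S (\<lambda>a. {h a}) ?W k m"
    using single_heads[OF fin m(3) H] by blast
  obtain r where r: "\<And>i. i < k \<Longrightarrow> r i \<in> ?V" "\<And>v. v \<in> ?V \<Longrightarrow> card {i. i < k \<and> r i = v} = m v"
    using family_with_multiplicities[OF fin(1), of m] m(2) by auto
  \<comment> \<open>For \<open>{X}\<close> the demand reads \<open>k \<le> indeg + sum m X\<close>.
    Since \<open>sum m X\<close> counts the roots inside \<open>X\<close>, what remains of
    \<open>k\<close> counts the roots outside, which is Edmonds' condition.\<close>
  have "avoiding k (\<lambda>i. {r i}) X \<le> indeg ?S h ?W X" if X: "X \<subseteq> ?V" "X \<noteq> {}" for X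
  proof -
    have "{..<k} = {i. i < k \<and> {r i} \<inter> X = {}} \<union> {i. i < k \<and> r i \<in> X}" by auto
    then have "k = card ({i. i < k \<and> {r i} \<inter> X = {}} \<union> {i. i < k \<and> r i \<in> X})"
      by (metis card_lessThan)
    also have "\<dots> = avoiding k (\<lambda>i. {r i}) X + card {i. i < k \<and> r i \<in> X}"
      unfolding avoiding_def by (rule card_Un_disjoint) auto
    also have "card {i. i < k \<and> r i \<in> X} = sum m X"
      using r(2) X fin(1) finite_subset by (subst card_preimage) (auto intro!: sum.cong)
    finally have "k = avoiding k (\<lambda>i. {r i}) X + sum m X" .
    moreover have "subpartition ?V {X}" using X by (auto simp: subpartition_def)
    then have "k * card {X} \<le> cross_num ?S (\<lambda>a. {h a}) ?W {X} + sum m (\<Union>{X})"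
      using h(2) unfolding demand_met_def by blast
    ultimately show ?thesis by (simp add: cross_num_def indeg_def crosses_singleton)
  qed
  moreover have "h a \<in> ?W a \<and> ?W a \<subseteq> ?V" if "a \<in> ?S" for a
    using h(1)[OF that] edge_props[OF that] by blast
  ultimately obtain B where B: "disjoint_family_on B {..<k}"
    "\<And>i. i < k \<Longrightarrow> B i \<subseteq> ?S \<and> spans ?V h ?W {r i} (B i)"
    using disjoint_branchings[OF fin, of h ?W k "\<lambda>i. {r i}"] r(1) by (metis empty_subsetI insert_not_empty insert_subset)
  have "spanning_hyperarborescence F (r i) (Inl -` B i) (Inr -` B i)" if "i < k" for i
    using B(2)[OF that] h(1) r(1)[OF that] by (intro spanning_hyperarborescenceI[OF F]) auto
  moreover have "disjoint_family_on (\<lambda>i. Inl -` B i) {..<k}" "disjoint_family_on (\<lambda>i. Inr -` B i) {..<k}"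
    using B(1) by (auto simp: disjoint_family_on_def)
  ultimately have "flexible_packing F k f g r (\<lambda>i. Inl -` B i) (\<lambda>i. Inr -` B i)"
    using m(1) r(2) by (auto simp: flexible_packing_def hyperarborescence_packing_def)
  then show ?thesis by blast
qed

theorem theorem6:
  fixes F :: "('v, 'd, 'e) mixed_hgraph" and k :: nat and f g :: "'v \<Rightarrow> nat"
  assumes "mixed_hypergraph F"
  shows "(\<exists>r A E. flexible_packing F k f g r A E) \<longleftrightarrow>
    (\<forall>v \<in> vertices F. f v \<le> g v) \<and>
    (\<forall>P. subpartition (vertices F) P \<longrightarrow>
       int (entering_number F P)
         \<ge> int k * (int (card P) - 1) + (\<Sum>v \<in> vertices F - \<Union>P. int (f v))) \<and>
    (\<forall>P. subpartition (vertices F) P \<longrightarrow>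
       int (entering_number F P) \<ge> int k * int (card P) - (\<Sum>v \<in> \<Union>P. int (g v)))"
    (is "?L \<longleftrightarrow> ?fg \<and> ?lower \<and> ?upper")
proof -
  interpret mixed_hypergraph F by fact
  let ?V = "vertices F"
  have lower: "?lower \<longleftrightarrow> (\<forall>P. subpartition ?V P \<longrightarrow>
      k * card P + sum f (?V - \<Union>P) \<le> entering_number F P + k)"
  proof -
    have "int k * (int (card P) - 1) + (\<Sum>v\<in>?V - \<Union>P. int (f v)) \<le> int (entering_number F P) \<longleftrightarrow>
        k * card P + sum f (?V - \<Union>P) \<le> entering_number F P + k" for P
    proof -
      have "int k * (int (card P) - 1) = int (k * card P) - int k" by (simp add: algebra_simps)
      then show ?thesis by (simp only: of_nat_sum[symmetric]) linarith
    qed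
    then show ?thesis by simp
  qed
  have upper: "?upper \<longleftrightarrow> (\<forall>P. subpartition ?V P \<longrightarrow>
      k * card P \<le> entering_number F P + sum g (\<Union>P))"
  proof -
    have "int k * int (card P) - (\<Sum>v\<in>\<Union>P. int (g v)) \<le> int (entering_number F P) \<longleftrightarrow>
        k * card P \<le> entering_number F P + sum g (\<Union>P)" for P
      by (simp only: of_nat_sum[symmetric] of_nat_mult[symmetric]) linarith
    then show ?thesis by simp
  qed
  show ?thesis
  proof
    assume ?L
    then obtain r A E where pack: "flexible_packing F k f g r A E" by blast
    let ?m = "\<lambda>v. card {i. i < k \<and> r i = v}"
    have m: "f v \<le> ?m v \<and> ?m v \<le> g v" if "v \<in> ?V" for v
      using pack that by (simp add: flexible_packing_def)
    have rV: "r i \<in> ?V" if "i < k" for i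
      using pack that
      by (simp add: flexible_packing_def hyperarborescence_packing_def spanning_hyperarborescence_def)
    \<comment> \<open>With actual root counts \<open>?m\<close> of total \<open>k\<close>, the bound
      for \<open>f\<close> follows from \<open>f \<le> ?m\<close> outside \<open>\<Union>P\<close>,
      and the bound for \<open>g\<close> from \<open>?m \<le> g\<close> inside it.\<close>
    have "k * card P + sum f (?V - \<Union>P) \<le> entering_number F P + k \<and>
        k * card P \<le> entering_number F P + sum g (\<Union>P)" if P: "subpartition ?V P" for P
    proof -
      have PV: "\<Union>P \<subseteq> ?V" using P by (simp add: subpartition_def)
      then have finP: "finite (\<Union>P)" using finite_vertices finite_subset by blast
      have "{i. i < k \<and> r i \<in> ?V} = {..<k}" using rV by auto
      then have "k = sum ?m ?V" using card_preimage[OF finite_vertices, of k r] by simp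
      also have "\<dots> = sum ?m (?V - \<Union>P) + sum ?m (\<Union>P)"
        using PV finite_vertices by (rule sum.subset_diff)
      finally have "k = sum ?m (?V - \<Union>P) + sum ?m (\<Union>P)" .
      moreover have "k * card P \<le> entering_number F P + sum ?m (\<Union>P)"
        using flexible_packing_necessary[OF assms pack P] by (simp only: card_preimage[OF finP])
      moreover have "sum f (?V - \<Union>P) \<le> sum ?m (?V - \<Union>P)" using m by (intro sum_mono) auto
      moreover have "sum ?m (\<Union>P) \<le> sum g (\<Union>P)" using m PV by (intro sum_mono) auto
      ultimately show ?thesis by linarith
    qed
    moreover have ?fg using m le_trans by blast
    ultimately show "?fg \<and> ?lower \<and> ?upper" unfolding lower upper by blast
  next
    assume "?fg \<and> ?lower \<and> ?upper"
    then show ?L unfolding lower upper by (intro flexible_packing_exists[OF assms]) auto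
  qed
qed

end
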